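(* Let $\omega_+,\omega_-$ be complex-valued functions defined near a point $\mathbf{p}_0\in\mathbb{R}^3$ such that $h(\mathbf{p}):=[\omega_+(\mathbf{p})-\omega_-(\mathbf{p})]^2$ is a smooth complex-valued function near $\mathbf{p}_0$ with $h(\mathbf{p}_0)=0$. Write $h=F_1+\mathrm{i}F_2$ with $F_1,F_2$ real-valued, assume that $\nabla F_1(\mathbf{p}_0)$ and $\nabla F_2(\mathbf{p}_0)$ are linearly independent, and set $$\mathbf{K}=\nabla F_1\nabla F_1^{\mathrm{T}}+\nabla F_2\nabla F_2^{\mathrm{T}}\quad(\text{gradients at }\mathbf{p}_0),\qquad \mathbf{T}=\frac{\nabla F_1\times\nabla F_2}{\|\nabla F_1\times\nabla F_2\|},\qquad C_{\widehat{\mathbf{u}}}=\big(\widehat{\mathbf{u}}^{\mathrm{T}}\mathbf{K}\,\widehat{\mathbf{u}}\big)^{1/4}$$ for unit vectors $\widehat{\mathbf{u}}\in\mathbb{R}^3$. Then: (i) For every unit vector $\widehat{\mathbf{u}}$ with $\nabla h(\mathbf{p}_0)\cdot\widehat{\mathbf{u}}\neq0$, one has $C_{\widehat{\mathbf{u}}}=|\nabla h(\mathbf{p}_0)\cdot\widehat{\mathbf{u}}|^{1/2}$ and, as $\epsilon\to0^+$, $$\big|\omega_+(\mathbf{p}_0+\epsilon\widehat{\mathbf{u}})-\omega_-(\mathbf{p}_0+\epsilon\widehat{\mathbf{u}})\big|=C_{\widehat{\mathbf{u}}}\sqrt{\epsilon}+o(\sqrt{\epsilon}).$$ (ii) $\mathbf{T}$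 is a null vector of $\mathbf{K}$, so $C_{\mathbf{T}}=0$, and $|\omega_+(\mathbf{p}_0+\epsilon\mathbf{T})-\omega_-(\mathbf{p}_0+\epsilon\mathbf{T})|=\mathcal{O}(\epsilon)$ as $\epsilon\to0^+$. (iii) The eigenvalues of $\mathbf{K}$ are $0=\lambda_0<\lambda_-\le\lambda_+$, and over unit vectors $\widehat{\mathbf{u}}$ orthogonal to $\mathbf{T}$ the minimum and maximum of $C_{\widehat{\mathbf{u}}}$ are $\lambda_-^{1/4}$ and $\lambda_+^{1/4}$ respectively, attained at corresponding eigenvectors of $\mathbf{K}$.
   Context: Gradients are column vectors; $\nabla h=\nabla F_1+\mathrm{i}\nabla F_2\in\mathbb{C}^3$ and $\nabla h\cdot\widehat{\mathbf{u}}=\sum_a \partial_a h\,\widehat u_a$ (no complex conjugation). $\|\cdot\|$ is the Euclidean norm. The functions $\omega_\pm$ model two eigenvalue (quasinormal frequency) branches coalescing at $\mathbf{p}_0$; individually they need not be continuous or smooth, only the squared difference $h$ is assumed smooth. Near $\mathbf{p}_0$ the set $\{F_1=F_2=0\}$ is a smooth curve (the exceptional line), with unit tangent $\mathbf{T}$ at $\mathbf{p}_0$. *)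

theory Defs
  imports "HOL-Analysis.Analysis" "HOL-Library.Landau_Symbols"
begin

text \<open>
  Continuous differentiability of order \<open>k\<close>, by recursion on directional derivatives.
  Only meaningful on open sets, since the derivative is taken at \<open>at x\<close>.
\<close>

fun Ck_on :: "nat \<Rightarrow> 'a::real_normed_vector set \<Rightarrow> ('a \<Rightarrow> 'b::real_normed_vector) \<Rightarrow> bool"
  where
    "Ck_on 0 S f \<longleftrightarrow> continuous_on S f"
  | "Ck_on (Suc k) S f \<longleftrightarrow>
      (\<forall>x\<in>S. f differentiable (at x)) \<and>
      (\<forall>v. Ck_on k S (\<lambda>x. frechet_derivative f (at x) v))"

definition smooth_near :: "('a::real_normed_vector \<Rightarrow> 'b::real_normed_vector) \<Rightarrow> 'a \<Rightarrow> bool"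
  where "smooth_near f p \<longleftrightarrow> (\<exists>U. open U \<and> p \<in> U \<and> (\<forall>k. Ck_on k U f))"

definition grad :: "(real^'n \<Rightarrow> real) \<Rightarrow> real^'n \<Rightarrow> real^'n"
  where "grad f p = (\<chi> a. frechet_derivative f (at p) (axis a 1))"

definition outer :: "real^'n \<Rightarrow> real^'n \<Rightarrow> real^'n^'n"
  where "outer v w = (columnvector v :: real^1^'n) ** (rowvector w :: real^'n^1)"

definition is_eigenvector :: "real^'n^'n \<Rightarrow> real \<Rightarrow> real^'n \<Rightarrow> bool"
  where "is_eigenvector A l v \<longleftrightarrow> v \<noteq> 0 \<and> A *v v = l *\<^sub>R v"

text \<open>The bilinear product \<open>w \<cdot> u\<close> of a complex and a real vector, without conjugation.\<close>

definition cdot :: "complex^'n \<Rightarrow> real^'n \<Rightarrow> complex"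
  where "cdot w u = (\<Sum>a\<in>UNIV. w $ a * complex_of_real (u $ a))"

end

theory Submission
  imports Defs
begin

text \<open>
  Along a line through \<open>p\<^sub>0\<close> in direction \<open>u\<close>, the modulus of \<open>\<omega>\<^sub>p - \<omega>\<^sub>m\<close> is the square root of \<open>|h|\<close>,
  so only the Taylor expansion of \<open>h\<close> matters: it is linear with slope \<open>\<nabla>h \<cdot> u\<close> in general, and
  quadratic if \<open>u = T\<close>, where the slope vanishes. The quadratic form of \<open>K\<close> is \<open>|\<nabla>h \<cdot> u|\<^sup>2\<close>.
  Its characteristic polynomial has the root \<open>0\<close> and two roots with sum \<open>|g\<^sub>1|\<^sup>2 + |g\<^sub>2|\<^sup>2\<close> and
  product \<open>|g\<^sub>1 \<times> g\<^sub>2|\<^sup>2 > 0\<close>; the extremal property follows by expanding \<open>u\<close> in an orthonormal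
  eigenbasis.
\<close>

section \<open>Rank-two sums of outer products and their spectrum in dimension three\<close>

lemma outer_mult_vec: "outer v w *v x = (w \<bullet> x) *\<^sub>R v"
  by (simp add: outer_def columnvector_def rowvector_def matrix_matrix_mult_def
      matrix_vector_mult_def vec_eq_iff inner_vec_def sum_distrib_right sum_distrib_left ac_simps)

lemma sum_outer_mult_vec:
  "(outer a a + outer b b) *v x = (a \<bullet> x) *\<^sub>R a + (b \<bullet> x) *\<^sub>R b"
  by (simp add: matrix_vector_mult_add_rdistrib outer_mult_vec)

text \<open>There is no constant term because the matrix has rank at most 2. The other coefficients
  come from its trace and from the sum of its principal 2x2 minors, which is the Gram determinant of
  \<open>a\<close> and \<open>b\<close>.\<close>

lemma det_char_sum_outer:
  fixes a b :: "real^3"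
  shows "det (mat x - (outer a a + outer b b)) =
    x * (x\<^sup>2 - (a \<bullet> a + b \<bullet> b) * x + ((a \<bullet> a) * (b \<bullet> b) - (a \<bullet> b)\<^sup>2))"
  by (simp add: det_3 outer_def columnvector_def rowvector_def matrix_matrix_mult_def mat_def
      inner_vec_def sum_3 power2_eq_square algebra_simps)

text \<open>An eigenvector is a nonzero kernel vector of \<open>mat l - A\<close>, and a square
  matrix has one exactly when it is singular.\<close>

lemma eigenvector_iff_det:
  "(\<exists>v. is_eigenvector A l v) \<longleftrightarrow> det (mat l - A) = 0"
proof -
  have "(mat l - A) *v v = l *\<^sub>R v - A *v v" for v
  proof -
    have "mat l *v v = l *\<^sub>R v"
      by (simp add: mat_def matrix_vector_mult_def vec_eq_iff if_distrib [where f="\<lambda>x. x * _"] cong: if_cong)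
    then show ?thesis by (simp add: matrix_vector_mult_diff_rdistrib)
  qed
  then have "(\<exists>v. is_eigenvector A l v) \<longleftrightarrow> \<not> (\<forall>v. (mat l - A) *v v = 0 \<longrightarrow> v = 0)"
    by (metis is_eigenvector_def right_minus_eq)
  then show ?thesis
    by (simp add: matrix_left_invertible_ker [symmetric] invertible_left_inverse [symmetric]
        invertible_det_nz)
qed

text \<open>The condition \<open>a \<noteq> b\<close> keeps \<open>{a, b}\<close> from collapsing to
  a singleton, which is independent for every nonzero \<open>a\<close> although
  \<open>cross3 a a = 0\<close>.\<close>

lemma cross3_nonzero_if_independent:
  fixes a b :: "real^3"
  assumes "a \<noteq> b" "independent {a, b}"
  shows "cross3 a b \<noteq> 0"
proof
  assume "cross3 a b = 0"
  then have "collinear {0, a, b}" by (simp add: cross_eq_0)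
  then consider "a = 0" | "b = 0" | c where "b = c *\<^sub>R a" by (auto simp: collinear_lemma)
  then show False
  proof cases
    case 1
    then show False using assms by (auto simp: dependent_zero)
  next
    case 2
    then show False using assms by (auto simp: dependent_zero)
  next
    case (3 c)
    then have "b \<in> span {a}" by (simp add: span_base span_scale)
    moreover have "insert b {a} = {a, b}" by auto
    ultimately show False using assms independent_insert [of b "{a}"] by auto
  qed
qed

text \<open>The remainder \<open>w\<close> of \<open>v\<close> after removing its three components
  is orthogonal to \<open>s\<close>, \<open>t\<close> and \<open>r\<close>. Being orthogonal to
  \<open>s\<close> and \<open>t\<close> also makes it parallel to \<open>r\<close>, so it
  vanishes.\<close>

lemma orthonormal_expansion3:
  fixes s t v :: "real^3"
  assumes s: "norm s = 1" and t: "norm t = 1" and st: "s \<bullet> t = 0"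
  defines "r \<equiv> cross3 s t"
  shows "norm r = 1" and "r \<bullet> s = 0" and "r \<bullet> t = 0"
    and "v = (v \<bullet> s) *\<^sub>R s + (v \<bullet> t) *\<^sub>R t + (v \<bullet> r) *\<^sub>R r"
proof -
  have "(norm r)\<^sup>2 = 1" using norm_cross [of s t] s t st by (simp add: r_def)
  then show r: "norm r = 1" by (simp add: power2_eq_1_iff) (smt (verit) norm_ge_zero)
  show rs: "r \<bullet> s = 0" and rt: "r \<bullet> t = 0"
    by (auto simp: r_def dot_cross_self inner_commute)
  have one: "s \<bullet> s = 1" "t \<bullet> t = 1" "r \<bullet> r = 1"
    using s t r by (auto simp: dot_square_norm)
  define w where "w = v - ((v \<bullet> s) *\<^sub>R s + (v \<bullet> t) *\<^sub>R t + (v \<bullet> r) *\<^sub>R r)"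
  have ws: "w \<bullet> s = 0" and wt: "w \<bullet> t = 0" and wr: "w \<bullet> r = 0"
    using one st rs rt by (simp_all add: w_def algebra_simps inner_commute)
  have "cross3 w r = 0" unfolding r_def using Lagrange [of w s t] ws wt by simp
  with wr have "w = 0 \<or> r = 0" using norm_and_cross_eq_0 [of w r] by auto
  with r have "w = 0" by auto
  then show "v = (v \<bullet> s) *\<^sub>R s + (v \<bullet> t) *\<^sub>R t + (v \<bullet> r) *\<^sub>R r" by (simp add: w_def)
qed

text \<open>The factorised determinant records multiplicities, which the set
  \<open>{0, l, m}\<close> loses when \<open>l = m\<close>.\<close>

lemma spectrum_sum_outer:
  fixes a b :: "real^3"
  defines "K \<equiv> outer a a + outer b b"
    and "T \<equiv> (1 / norm (cross3 a b)) *\<^sub>R cross3 a b"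
  assumes nz: "cross3 a b \<noteq> 0"
  obtains l m where "0 < l" "l \<le> m" "{x. \<exists>v. is_eigenvector K x v} = {0, l, m}"
    "\<And>x. det (mat x - K) = x * (x - l) * (x - m)"
    "\<And>u. norm u = 1 \<Longrightarrow> u \<bullet> T = 0 \<Longrightarrow> l \<le> u \<bullet> (K *v u) \<and> u \<bullet> (K *v u) \<le> m"
proof -
  define p q where "p = a \<bullet> a" and "q = b \<bullet> b"
  \<comment> \<open>The discriminant of the quadratic factor of the characteristic polynomial,
    written as a sum of squares so that both roots are visibly real.\<close>
  define d where "d = (p - q)\<^sup>2 + 4 * (a \<bullet> b)\<^sup>2"
  define l m where "l = (p + q - sqrt d) / 2" and "m = (p + q + sqrt d) / 2"
  have d: "d \<ge> 0" by (simp add: d_def)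
  have sum: "l + m = p + q" by (simp add: l_def m_def field_simps)
  have "l * m = ((p + q)\<^sup>2 - (sqrt d)\<^sup>2) / 4"
    by (simp add: l_def m_def field_simps power2_eq_square)
  also have "\<dots> = p * q - (a \<bullet> b)\<^sup>2"
    unfolding real_sqrt_pow2 [OF d] by (simp add: d_def power2_eq_square field_simps)
  finally have prod: "l * m = p * q - (a \<bullet> b)\<^sup>2" .
  have "p * q - (a \<bullet> b)\<^sup>2 = (norm (cross3 a b))\<^sup>2"
    by (simp add: norm_cross p_def q_def dot_square_norm)
  with nz prod have pos: "l * m > 0" by simp
  have lm: "l \<le> m" using d by (simp add: l_def m_def)
  have "p \<ge> 0" "q \<ge> 0" by (auto simp: p_def q_def)
  \<comment> \<open>A positive product gives both roots the same sign, and their nonnegative sum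
    excludes the negative one.\<close>
  with sum pos lm have l: "0 < l" by (smt (verit) zero_less_mult_iff)
  have char: "det (mat x - K) = x * (x - l) * (x - m)" for x
  proof -
    have "det (mat x - K) = x * (x\<^sup>2 - (l + m) * x + l * m)"
      unfolding K_def det_char_sum_outer sum prod by (simp add: p_def q_def)
    then show ?thesis by (simp add: power2_eq_square algebra_simps)
  qed
  have eig: "{x. \<exists>v. is_eigenvector K x v} = {0, l, m}"
    by (auto simp: eigenvector_iff_det char)
  have K: "K *v x = (a \<bullet> x) *\<^sub>R a + (b \<bullet> x) *\<^sub>R b" for x
    by (simp add: K_def sum_outer_mult_vec)
  have sym: "x \<bullet> (K *v y) = (K *v x) \<bullet> y" for x y
    by (simp add: K inner_simps inner_commute)
  have aT: "a \<bullet> T = 0" and bT: "b \<bullet> T = 0" by (simp_all add: T_def dot_cross_self)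
  have T: "norm T = 1" using nz by (simp add: T_def)
  have KT: "K *v T = 0" by (simp add: K aT bT)
  \<comment> \<open>The determinant supplies an eigenvector for \<open>l\<close> only. The third
    basis vector is then a cross product, which avoids a separate case for
    \<open>l = m\<close>.\<close>
  from eig obtain v where v: "v \<noteq> 0" "K *v v = l *\<^sub>R v" by (auto simp: is_eigenvector_def)
  define e where "e = (1 / norm v) *\<^sub>R v"
  have e: "norm e = 1" "K *v e = l *\<^sub>R e"
    using v by (simp_all add: e_def matrix_vector_mult_scaleR)
  have Te: "T \<bullet> e = 0" using sym [of T e] e l KT by simp
  define r where "r = cross3 T e"
  note r = orthonormal_expansion3 [OF T e(1) Te, folded r_def]
  define k where "k = r \<bullet> (K *v r)"
  \<comment> \<open>By symmetry, \<open>K\<close> preserves the orthogonal complement of its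
    eigenvectors \<open>T\<close> and \<open>e\<close>, which is the line through
    \<open>r\<close>.\<close>
  have "K *v r = k *\<^sub>R r"
  proof -
    have "(K *v r) \<bullet> T = 0" using sym [of T r] KT by (simp add: inner_commute)
    moreover have "(K *v r) \<bullet> e = 0" using sym [of e r] e(2) r(3) by (simp add: inner_commute)
    moreover have "(K *v r) \<bullet> r = k" by (simp add: k_def inner_commute)
    ultimately show ?thesis by (subst r(4) [of "K *v r"]) simp
  qed
  \<comment> \<open>The trace of \<open>K\<close>, computed in the orthonormal basis \<open>T, e, r\<close>, identifies the third eigenvalue.\<close>
  have pars: "x \<bullet> x = (x \<bullet> T)\<^sup>2 + (x \<bullet> e)\<^sup>2 + (x \<bullet> r)\<^sup>2" for x
    using arg_cong [OF r(4) [of x], of "\<lambda>y. x \<bullet> y"] by (simp add: inner_simps power2_eq_square)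
  have quad: "x \<bullet> (K *v x) = (a \<bullet> x)\<^sup>2 + (b \<bullet> x)\<^sup>2" for x
    by (simp add: K inner_simps inner_commute power2_eq_square)
  have "e \<bullet> (K *v e) = l" using e by (simp add: dot_square_norm)
  then have "p + q = l + k"
    using pars [of a] pars [of b] aT bT quad [of e] quad [of r] by (simp add: p_def q_def k_def)
  with sum have km: "k = m" by simp
  have "l \<le> u \<bullet> (K *v u) \<and> u \<bullet> (K *v u) \<le> m" if u: "norm u = 1" "u \<bullet> T = 0" for u
  proof -
    have uu: "(u \<bullet> e)\<^sup>2 + (u \<bullet> r)\<^sup>2 = 1" using pars [of u] u by (simp add: dot_square_norm)
    have "u = (u \<bullet> e) *\<^sub>R e + (u \<bullet> r) *\<^sub>R r" by (subst r(4) [of u]) (simp add: u)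
    then have "K *v u = (u \<bullet> e) *\<^sub>R (l *\<^sub>R e) + (u \<bullet> r) *\<^sub>R (m *\<^sub>R r)"
      using e \<open>K *v r = k *\<^sub>R r\<close> km by (metis matrix_vector_mult_scaleR matrix_vector_right_distrib)
    then have "u \<bullet> (K *v u) = l * (u \<bullet> e)\<^sup>2 + m * (u \<bullet> r)\<^sup>2"
      by (simp add: inner_simps power2_eq_square)
    \<comment> \<open>In this form both bounds reduce to \<open>(u \<bullet> r)\<^sup>2\<close>
      lying between 0 and 1.\<close>
    also have "\<dots> = l * ((u \<bullet> e)\<^sup>2 + (u \<bullet> r)\<^sup>2) + (m - l) * (u \<bullet> r)\<^sup>2"
      by (simp add: algebra_simps)
    finally have 1: "u \<bullet> (K *v u) = l + (m - l) * (u \<bullet> r)\<^sup>2" by (simp add: uu)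
    have "(u \<bullet> r)\<^sup>2 \<le> 1" using uu by (smt (verit) zero_le_power2)
    then have "(m - l) * (u \<bullet> r)\<^sup>2 \<le> (m - l) * 1" using lm by (intro mult_left_mono) auto
    moreover have "0 \<le> (m - l) * (u \<bullet> r)\<^sup>2" using lm by simp
    ultimately show ?thesis unfolding 1 by simp
  qed
  then show ?thesis using that l lm eig char by blast
qed

section \<open>First- and second-order estimates along a line\<close>

lemma smooth_near_imp_C2:
  assumes "smooth_near f p"
  obtains U where "open U" "p \<in> U" "\<And>x. x \<in> U \<Longrightarrow> f differentiable (at x)"
    "\<And>v. (\<lambda>x. frechet_derivative f (at x) v) differentiable (at p)"
proof -
  \<comment> \<open>Two levels of the recursion give differentiability near \<open>p\<close> and a
    second derivative at \<open>p\<close>.\<close>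
  from assms obtain U where U: "open U" "p \<in> U" "Ck_on (Suc (Suc 0)) U f"
    unfolding smooth_near_def by blast
  from U show ?thesis by (intro that [of U]) auto
qed

lemma differentiable_along_line:
  assumes "f differentiable (at (p + t *\<^sub>R u))"
  shows "((\<lambda>t. f (p + t *\<^sub>R u)) has_vector_derivative frechet_derivative f (at (p + t *\<^sub>R u)) u) (at t)"
proof -
  let ?D = "frechet_derivative f (at (p + t *\<^sub>R u))"
  have D: "(f has_derivative ?D) (at (p + t *\<^sub>R u))"
    using assms by (simp add: frechet_derivative_works)
  have "((\<lambda>t. p + t *\<^sub>R u) has_derivative (\<lambda>s. s *\<^sub>R u)) (at t)"
    by (auto intro!: derivative_eq_intros)
  from diff_chain_at [OF this D]
  show ?thesis
    using has_derivative_linear [OF D] by (simp add: has_vector_derivative_def o_def linear_cmul)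
qed

text \<open>Serves twice: for \<open>h\<close> along a line it gives the square-root law, and for
  the derivative in the next lemma a linear bound.\<close>

lemma norm_difference_quotient_tendsto:
  fixes f :: "real \<Rightarrow> 'a::real_normed_vector"
  assumes "(f has_vector_derivative f') (at 0)" and "f 0 = 0"
  shows "((\<lambda>t. norm (f t) / t) \<longlongrightarrow> norm f') (at_right 0)"
proof -
  have "((\<lambda>t. f t /\<^sub>R t - f') \<longlongrightarrow> 0) (at 0)"
  proof -
    have "((\<lambda>t. norm (f t - t *\<^sub>R f') / norm t) \<longlongrightarrow> 0) (at 0)"
      using assms by (simp add: has_vector_derivative_def has_derivative_at)
    moreover have "\<forall>\<^sub>F t in at 0. norm (f t - t *\<^sub>R f') / norm t = norm (f t /\<^sub>R t - f')"
    proof (rule eventually_mono [OF eventually_at_ball' [OF zero_less_one, of 0 UNIV]])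
      fix t :: real assume "t \<in> ball 0 1 \<and> t \<noteq> 0 \<and> t \<in> UNIV"
      then have "f t /\<^sub>R t - f' = (f t - t *\<^sub>R f') /\<^sub>R t" by (simp add: scaleR_diff_right)
      then show "norm (f t - t *\<^sub>R f') / norm t = norm (f t /\<^sub>R t - f')"
        by (simp add: divide_inverse mult.commute)
    qed
    ultimately have "((\<lambda>t. norm (f t /\<^sub>R t - f')) \<longlongrightarrow> 0) (at 0)"
      by (simp add: tendsto_cong)
    then show ?thesis by (rule tendsto_norm_zero_cancel)
  qed
  then have "((\<lambda>t. f t /\<^sub>R t) \<longlongrightarrow> f') (at_right 0)"
    by (simp add: LIM_zero_iff filterlim_at_split)
  then have "((\<lambda>t. norm (f t /\<^sub>R t)) \<longlongrightarrow> norm f') (at_right 0)" by (rule tendsto_norm)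
  then show ?thesis
    by (rule tendsto_cong [THEN iffD1, rotated])
      (auto simp: eventually_at_filter divide_inverse mult.commute)
qed

text \<open>Since \<open>f'\<close> vanishes at 0 and is differentiable there, it is bounded by
  \<open>M * x\<close> for small \<open>x > 0\<close>; the mean value inequality on
  \<open>{0..t}\<close> then adds a second factor \<open>t\<close>.\<close>

lemma critical_point_bigo_square:
  fixes f :: "real \<Rightarrow> 'a::real_normed_vector"
  assumes f0: "f 0 = 0" and f'0: "f' 0 = 0"
    and ev: "\<forall>\<^sub>F t in nhds 0. (f has_vector_derivative f' t) (at t)"
    and f'': "(f' has_vector_derivative f'') (at 0)"
  obtains M where "0 \<le> M" "\<forall>\<^sub>F t in at_right 0. norm (f t) \<le> M * t\<^sup>2"
proof -
  \<comment> \<open>The summand 1 turns the limit \<open>norm f''\<close> into a strict upper bound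
    that holds eventually.\<close>
  define M where "M = norm f'' + 1"
  have "((\<lambda>t. norm (f' t) / t) \<longlongrightarrow> norm f'') (at_right 0)"
    using norm_difference_quotient_tendsto [OF f'' f'0] .
  then have "\<forall>\<^sub>F t in at_right 0. norm (f' t) / t < M"
    by (rule order_tendstoD) (simp add: M_def)
  then obtain b where b: "b > 0" "\<And>t. 0 < t \<Longrightarrow> t < b \<Longrightarrow> norm (f' t) / t < M"
    by (auto simp: eventually_at_right_field)
  obtain c where c: "c > 0" "\<And>t. \<bar>t\<bar> < c \<Longrightarrow> (f has_vector_derivative f' t) (at t)"
    using ev unfolding eventually_nhds_metric dist_real_def diff_0_right by blast
  have "norm (f t) \<le> M * t\<^sup>2" if t: "0 < t" "t < min b c" for t
  proof -
    have deriv: "(f has_vector_derivative f' x) (at x within {0..t})" if "x \<in> {0..t}" for x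
      by (rule has_vector_derivative_at_within, rule c(2)) (use that t in auto)
    have bound: "norm (f' x - f' 0) \<le> M * t" if x: "x \<in> {0..t}" for x
    \<comment> \<open>The quotient bound is available only for \<open>x > 0\<close>; at the endpoint
      the left side is 0.\<close>
    proof (cases "x = 0")
      case True
      then show ?thesis using t by (simp add: M_def)
    next
      case False
      then have "norm (f' x) \<le> M * x"
        using b(2) [of x] x t by (simp add: pos_divide_less_eq less_imp_le)
      also have "\<dots> \<le> M * t" using x by (intro mult_left_mono) (auto simp: M_def)
      finally show ?thesis by (simp add: f'0)
    qed
    have seg: "closed_segment 0 t \<subseteq> {0..t}" using t by (simp add: closed_segment_eq_real_ivl)
    have "norm (f t - f 0 - (t - 0) *\<^sub>R f' 0) \<le> norm (t - 0) * (M * t)"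
      by (rule vector_differentiable_bound_linearization [OF deriv seg bound]) (use t in auto)
    then show ?thesis using t by (simp add: f0 f'0 power2_eq_square ac_simps)
  qed
  then have "\<forall>\<^sub>F t in at_right 0. norm (f t) \<le> M * t\<^sup>2"
    unfolding eventually_at_right_field using b(1) c(1) by (intro exI [of _ "min b c"]) simp
  then show ?thesis by (intro that [of M]) (simp_all add: M_def)
qed

section \<open>The complex gradient and the quadratic form of \<open>K\<close>\<close>

lemma frechet_derivative_complex_eq_cdot:
  fixes h :: "real^'n \<Rightarrow> complex"
  assumes "h differentiable (at p)"
  shows "frechet_derivative h (at p) u =
    cdot (\<chi> a. complex_of_real (grad (\<lambda>p. Re (h p)) p $ a)
      + \<i> * complex_of_real (grad (\<lambda>p. Im (h p)) p $ a)) u"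
proof -
  let ?D = "frechet_derivative h (at p)"
  have D: "(h has_derivative ?D) (at p)" using assms by (simp add: frechet_derivative_works)
  then have lin: "linear ?D" by (rule has_derivative_linear)
  have "frechet_derivative (\<lambda>p. Re (h p)) (at p) = (\<lambda>x. Re (?D x))"
    "frechet_derivative (\<lambda>p. Im (h p)) (at p) = (\<lambda>x. Im (?D x))"
    using D by (auto intro!: frechet_derivative_at [symmetric] has_derivative_Re has_derivative_Im)
  then have *: "(\<chi> a. complex_of_real (grad (\<lambda>p. Re (h p)) p $ a)
      + \<i> * complex_of_real (grad (\<lambda>p. Im (h p)) p $ a)) = (\<chi> a. ?D (axis a 1))"
    by (simp add: grad_def vec_eq_iff complex_eq_iff)
  \<comment> \<open>The derivative is real-linear and the coordinates of \<open>u\<close> are real,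
    so they come out unchanged and the product carries no conjugation.\<close>
  have "?D u = ?D (\<Sum>a\<in>UNIV. (u $ a) *\<^sub>R axis a 1)"
    using basis_expansion [of u] by (simp add: scalar_mult_eq_scaleR)
  also have "\<dots> = (\<Sum>a\<in>UNIV. (u $ a) *\<^sub>R ?D (axis a 1))"
    using lin by (simp add: linear_sum linear_cmul)
  finally show ?thesis
    unfolding * by (simp add: cdot_def scaleR_conv_of_real mult.commute)
qed

text \<open>As \<open>u\<close> is real, the two inner products are the real and imaginary parts of
  the complex one.\<close>

lemma cmod_cdot_eq:
  "(cmod (cdot (\<chi> a. complex_of_real (g $ a) + \<i> * complex_of_real (g' $ a)) u))\<^sup>2
    = (g \<bullet> u)\<^sup>2 + (g' \<bullet> u)\<^sup>2"
  by (simp add: cmod_power2 cdot_def inner_vec_def)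

lemma root_4_square: "0 \<le> x \<Longrightarrow> root 4 (x\<^sup>2) = sqrt x"
  using real_root_mult_exp [of 2 2 "x\<^sup>2"] by (simp add: sqrt_def real_root_power_cancel)

section \<open>Splitting asymptotics and extremal directions\<close>

theorem mainTheorem2:
  fixes \<omega>\<^sub>p \<omega>\<^sub>m h :: "real^3 \<Rightarrow> complex"
    and F\<^sub>1 F\<^sub>2 C :: "real^3 \<Rightarrow> real"
    and p\<^sub>0 g\<^sub>1 g\<^sub>2 T :: "real^3"
    and gh :: "complex^3"
    and K :: "real^3^3"
  assumes h_eq: "h = (\<lambda>p. (\<omega>\<^sub>p p - \<omega>\<^sub>m p)\<^sup>2)"
    and smooth: "smooth_near h p\<^sub>0"
    and zero: "h p\<^sub>0 = 0"
    and F1_eq: "F\<^sub>1 = (\<lambda>p. Re (h p))"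
    and F2_eq: "F\<^sub>2 = (\<lambda>p. Im (h p))"
    and g1_eq: "g\<^sub>1 = grad F\<^sub>1 p\<^sub>0"
    and g2_eq: "g\<^sub>2 = grad F\<^sub>2 p\<^sub>0"
    and indep: "g\<^sub>1 \<noteq> g\<^sub>2 \<and> independent {g\<^sub>1, g\<^sub>2}"
    and gh_eq: "gh = (\<chi> a. complex_of_real (g\<^sub>1 $ a) + \<i> * complex_of_real (g\<^sub>2 $ a))"
    and K_eq: "K = outer g\<^sub>1 g\<^sub>1 + outer g\<^sub>2 g\<^sub>2"
    and T_eq: "T = (1 / norm (cross3 g\<^sub>1 g\<^sub>2)) *\<^sub>R cross3 g\<^sub>1 g\<^sub>2"
    and C_eq: "C = (\<lambda>u. root 4 (u \<bullet> (K *v u)))"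
  shows "(\<forall>u. norm u = 1 \<and> cdot gh u \<noteq> 0 \<longrightarrow>
            C u = sqrt (cmod (cdot gh u)) \<and>
            (\<lambda>\<epsilon>. cmod (\<omega>\<^sub>p (p\<^sub>0 + \<epsilon> *\<^sub>R u) - \<omega>\<^sub>m (p\<^sub>0 + \<epsilon> *\<^sub>R u)) - C u * sqrt \<epsilon>)
              \<in> o[at_right 0](\<lambda>\<epsilon>. sqrt \<epsilon>))
       \<and> (norm T = 1 \<and> K *v T = 0 \<and> C T = 0 \<and>
            (\<lambda>\<epsilon>. cmod (\<omega>\<^sub>p (p\<^sub>0 + \<epsilon> *\<^sub>R T) - \<omega>\<^sub>m (p\<^sub>0 + \<epsilon> *\<^sub>R T))) \<in> O[at_right 0](\<lambda>\<epsilon>. \<epsilon>))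
       \<and> (\<exists>l\<^sub>m l\<^sub>p. 0 < l\<^sub>m \<and> l\<^sub>m \<le> l\<^sub>p \<and>
            {l. \<exists>v. is_eigenvector K l v} = {0, l\<^sub>m, l\<^sub>p} \<and>
            (\<forall>x. det (mat x - K) = x * (x - l\<^sub>m) * (x - l\<^sub>p)) \<and>
            (\<forall>u. norm u = 1 \<and> u \<bullet> T = 0 \<longrightarrow> root 4 l\<^sub>m \<le> C u \<and> C u \<le> root 4 l\<^sub>p) \<and>
            (\<exists>u. norm u = 1 \<and> u \<bullet> T = 0 \<and> is_eigenvector K l\<^sub>m u) \<and>
            (\<forall>u. norm u = 1 \<and> is_eigenvector K l\<^sub>m u \<longrightarrow> u \<bullet> T = 0 \<and> C u = root 4 l\<^sub>m) \<and>
            (\<exists>u. norm u = 1 \<and> u \<bullet> T = 0 \<and> is_eigenvector K l\<^sub>p u) \<and>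
            (\<forall>u. norm u = 1 \<and> is_eigenvector K l\<^sub>p u \<longrightarrow> u \<bullet> T = 0 \<and> C u = root 4 l\<^sub>p))"
proof -
  let ?w = "\<lambda>u \<epsilon>. cmod (\<omega>\<^sub>p (p\<^sub>0 + \<epsilon> *\<^sub>R u) - \<omega>\<^sub>m (p\<^sub>0 + \<epsilon> *\<^sub>R u))"
  obtain U where U: "open U" "p\<^sub>0 \<in> U" "\<And>x. x \<in> U \<Longrightarrow> h differentiable (at x)"
    and D2: "\<And>v. (\<lambda>x. frechet_derivative h (at x) v) differentiable (at p\<^sub>0)"
    using smooth_near_imp_C2 [OF smooth] by blast
  define D where "D = (\<lambda>u x. frechet_derivative h (at x) u)"
  have D0: "D u p\<^sub>0 = cdot gh u" for u
    using frechet_derivative_complex_eq_cdot [of h "p\<^sub>0" u] U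
    by (simp add: D_def gh_eq g1_eq g2_eq F1_eq F2_eq)
  have deriv: "((\<lambda>t. h (p\<^sub>0 + t *\<^sub>R u)) has_vector_derivative D u (p\<^sub>0 + t *\<^sub>R u)) (at t)"
    if "p\<^sub>0 + t *\<^sub>R u \<in> U" for u t
    unfolding D_def using U that by (intro differentiable_along_line) auto
  have w: "?w u \<epsilon> = sqrt (cmod (h (p\<^sub>0 + \<epsilon> *\<^sub>R u)))" for u \<epsilon>
    by (simp add: h_eq norm_power)
  have quad: "u \<bullet> (K *v u) = (g\<^sub>1 \<bullet> u)\<^sup>2 + (g\<^sub>2 \<bullet> u)\<^sup>2" for u
    by (simp add: K_eq sum_outer_mult_vec inner_simps inner_commute power2_eq_square)
  have C: "C u = sqrt (cmod (cdot gh u))" for u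
    using root_4_square [of "cmod (cdot gh u)"] cmod_cdot_eq [of "g\<^sub>1" "g\<^sub>2" u]
    by (simp add: C_eq quad gh_eq)
  have nz: "cross3 g\<^sub>1 g\<^sub>2 \<noteq> 0" using cross3_nonzero_if_independent indep by blast
  have g1T: "g\<^sub>1 \<bullet> T = 0" and g2T: "g\<^sub>2 \<bullet> T = 0" by (simp_all add: T_eq dot_cross_self)
  have T: "norm T = 1" using nz by (simp add: T_eq)
  have KT: "K *v T = 0" by (simp add: K_eq sum_outer_mult_vec g1T g2T)
  have CT: "C T = 0" by (simp add: C_eq KT)

  have i: "(\<lambda>\<epsilon>. ?w u \<epsilon> - C u * sqrt \<epsilon>) \<in> o[at_right 0](\<lambda>\<epsilon>. sqrt \<epsilon>)" for u
  proof (rule smalloI_tendsto)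
    have "((\<lambda>t. cmod (h (p\<^sub>0 + t *\<^sub>R u)) / t) \<longlongrightarrow> cmod (cdot gh u)) (at_right 0)"
      using norm_difference_quotient_tendsto [OF deriv [where t=0 and u=u]] U zero D0 by simp
    then have "((\<lambda>t. sqrt (cmod (h (p\<^sub>0 + t *\<^sub>R u)) / t) - C u) \<longlongrightarrow> C u - C u) (at_right 0)"
      unfolding C by (intro tendsto_intros)
    then have "((\<lambda>t. sqrt (cmod (h (p\<^sub>0 + t *\<^sub>R u)) / t) - C u) \<longlongrightarrow> 0) (at_right 0)" by simp
    \<comment> \<open>For \<open>\<epsilon> > 0\<close> the quotient equals \<open>sqrt (cmod (h
      (p\<^sub>0 + \<epsilon> *\<^sub>R u)) / \<epsilon>) - C u\<close>.\<close>
    then show "((\<lambda>\<epsilon>. (?w u \<epsilon> - C u * sqrt \<epsilon>) / sqrt \<epsilon>) \<longlongrightarrow> 0) (at_right 0)"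
      by (rule tendsto_cong [THEN iffD1, rotated])
        (auto simp: eventually_at_filter w real_sqrt_divide diff_divide_distrib)
  qed (auto simp: eventually_at_filter)

  have ii: "?w T \<in> O[at_right 0](\<lambda>\<epsilon>. \<epsilon>)"
  proof -
    have "\<forall>\<^sub>F t in nhds 0. p\<^sub>0 + t *\<^sub>R T \<in> U"
    proof (rule topological_tendstoD [OF _ U(1)])
      show "((\<lambda>t. p\<^sub>0 + t *\<^sub>R T) \<longlongrightarrow> p\<^sub>0) (nhds 0)" by (auto intro!: tendsto_eq_intros filterlim_ident)
    qed (use U in auto)
    then have ev: "\<forall>\<^sub>F t in nhds 0.
        ((\<lambda>t. h (p\<^sub>0 + t *\<^sub>R T)) has_vector_derivative D T (p\<^sub>0 + t *\<^sub>R T)) (at t)"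
      by (rule eventually_mono) (rule deriv)
    have D2T: "((\<lambda>t. D T (p\<^sub>0 + t *\<^sub>R T)) has_vector_derivative
        frechet_derivative (D T) (at (p\<^sub>0 + 0 *\<^sub>R T)) T) (at 0)"
      using D2 by (intro differentiable_along_line) (simp add: D_def)
    \<comment> \<open>The slope of \<open>h\<close> along \<open>T\<close> has modulus
      \<open>(C T)\<^sup>2\<close>, which is 0 because \<open>T\<close> is a null vector of
      \<open>K\<close>.\<close>
    have DT: "D T (p\<^sub>0 + 0 *\<^sub>R T) = 0" using C [of T] CT D0 by simp
    have h0: "h (p\<^sub>0 + 0 *\<^sub>R T) = 0" using zero by simp
    obtain M where M: "0 \<le> M" "\<forall>\<^sub>F t in at_right 0. cmod (h (p\<^sub>0 + t *\<^sub>R T)) \<le> M * t\<^sup>2"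
      using critical_point_bigo_square [OF h0 DT ev D2T] by blast
    \<comment> \<open>The square root of the quadratic bound on \<open>h\<close> is linear in
      \<open>t\<close>, with constant \<open>sqrt M\<close>.\<close>
    have "\<forall>\<^sub>F t in at_right 0. norm (?w T t) \<le> sqrt M * norm t"
      using M(2) by (rule eventually_mono) (use real_sqrt_le_mono in \<open>fastforce simp: w real_sqrt_mult\<close>)
    then show ?thesis by (rule bigoI)
  qed

  obtain l m where lm: "0 < l" "l \<le> m" "{x. \<exists>v. is_eigenvector K x v} = {0, l, m}"
    "\<And>x. det (mat x - K) = x * (x - l) * (x - m)"
    "\<And>u. norm u = 1 \<Longrightarrow> u \<bullet> T = 0 \<Longrightarrow> l \<le> u \<bullet> (K *v u) \<and> u \<bullet> (K *v u) \<le> m"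
    using spectrum_sum_outer [OF nz, folded K_eq T_eq] by blast
  \<comment> \<open>Symmetry gives \<open>k * (u \<bullet> T) = u \<bullet> (K *v T) = 0\<close>, so
    a positive eigenvalue forces orthogonality to \<open>T\<close>. On a unit eigenvector the
    quadratic form equals \<open>k\<close>.\<close>
  have eig: "u \<bullet> T = 0 \<and> C u = root 4 k" if "norm u = 1" "is_eigenvector K k u" "0 < k" for u k
  proof
    have "u \<bullet> (K *v T) = (K *v u) \<bullet> T"
      by (simp add: K_eq sum_outer_mult_vec inner_simps inner_commute)
    with KT that show "u \<bullet> T = 0" by (simp add: is_eigenvector_def)
    show "C u = root 4 k" using that by (simp add: C_eq is_eigenvector_def dot_square_norm)
  qed
  have ex: "\<exists>u. norm u = 1 \<and> u \<bullet> T = 0 \<and> is_eigenvector K k u" if k: "k \<in> {l, m}" for k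
  proof -
    have "k \<in> {x. \<exists>v. is_eigenvector K x v}" using k lm(3) by auto
    then obtain v where "is_eigenvector K k v" by blast
    then have v: "v \<noteq> 0" "K *v v = k *\<^sub>R v" by (auto simp: is_eigenvector_def)
    define u where "u = (1 / norm v) *\<^sub>R v"
    have "norm u = 1" "is_eigenvector K k u"
      using v by (auto simp: u_def is_eigenvector_def matrix_vector_mult_scaleR)
    with eig [of u k] k lm show ?thesis by auto
  qed
  have bounds: "root 4 l \<le> C u \<and> C u \<le> root 4 m" if "norm u = 1" "u \<bullet> T = 0" for u
    using lm(5) [OF that] by (simp add: C_eq)
  have "0 < m" using lm by simp
  show ?thesis
  \<comment> \<open>The optional part fires only on the existential conjunct, with \<open>l\<close>
    and \<open>m\<close> as witnesses.\<close>
  proof (intro conjI; (rule exI [of _ l], rule exI [of _ m], intro conjI)?)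
    show "\<forall>u. norm u = 1 \<and> cdot gh u \<noteq> 0 \<longrightarrow> C u = sqrt (cmod (cdot gh u)) \<and>
        (\<lambda>\<epsilon>. ?w u \<epsilon> - C u * sqrt \<epsilon>) \<in> o[at_right 0](\<lambda>\<epsilon>. sqrt \<epsilon>)"
      using C i by blast
  qed (use T KT CT ii lm ex bounds eig [OF _ _ lm(1)] eig [OF _ _ \<open>0 < m\<close>] in simp_all)
qed

end
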